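(* Let $C : \mathsf{Form} \to \mathsf{Prop}$ be any predicate, $\mathsf{Code}$ any type and $\mathsf{eval} : \mathsf{Code} \to \mathsf{Code} \to \mathsf{Form}$ any function. Assume: (i) for every function $f : \mathsf{Code} \to \mathsf{Form}$ there exists $c \in \mathsf{Code}$ such that for all $x \in \mathsf{Code}$, $\mathsf{eval}(c,x) \simeq_C f(x)$; (ii) for all formulas $A,B$, if $C(A \to B)$ and $C(A)$ then $C(B)$; (iii) for every formula $A$, $C(A) \lor C(\neg A)$. Then there exists a formula $B$ such that $B \simeq_C \neg B$, and $C(B) \lor C(\neg B)$, and $C(\bot)$.
   Context: $\mathsf{Form}$ is the type of closed formulas generated by $A,B ::= \bot \mid A \to B$; $\neg A$ abbreviates $A \to \bot$. For a predicate $C$ on $\mathsf{Form}$, $A \simeq_C B$ means $C(A \to B) \land C(B \to A)$. *)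

theory Defs
  imports Main
begin

datatype form = Bot | Imp form form

abbreviation Neg :: "form \<Rightarrow> form" where
  "Neg A \<equiv> Imp A Bot"

definition form_equiv :: "(form \<Rightarrow> bool) \<Rightarrow> form \<Rightarrow> form \<Rightarrow> bool" where
  "form_equiv C A B \<longleftrightarrow> C (Imp A B) \<and> C (Imp B A)"

end

theory Submission
  imports Defs
begin

text \<open>This is Cantor's diagonal argument in the form of a liar sentence: a code for the
  negated diagonal of \<open>eval\<close>, applied to itself, yields a formula equivalent under
  \<open>C\<close> to its own negation. Deciding that formula either way forces both it and its
  negation into \<open>C\<close>, hence \<open>Bot\<close>.\<close>

theorem theorem3p7:
  fixes C :: "form \<Rightarrow> bool"
    and eval :: "'code \<Rightarrow> 'code \<Rightarrow> form"
  assumes representable: "\<And>f :: 'code \<Rightarrow> form. \<exists>c. \<forall>x. form_equiv C (eval c x) (f x)"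
    and modus_ponens: "\<And>A B. C (Imp A B) \<Longrightarrow> C A \<Longrightarrow> C B"
    and decides: "\<And>A. C A \<or> C (Neg A)"
  shows "\<exists>B. form_equiv C B (Neg B) \<and> (C B \<or> C (Neg B)) \<and> C Bot"
proof -
  obtain c where c: "\<forall>x. form_equiv C (eval c x) (Neg (eval x x))"
    using representable[of "\<lambda>x. Neg (eval x x)"] by blast
  define B where "B = eval c c"
  have fixpoint: "form_equiv C B (Neg B)"
    using c unfolding B_def by blast
  then have to_neg: "C (Imp B (Neg B))" and from_neg: "C (Imp (Neg B) B)"
    unfolding form_equiv_def by blast+
  \<comment> \<open>Whichever of the two \<open>decides\<close> provides, one half of the fixpoint
    equivalence carries it to the other.\<close>
  have "C B \<and> C (Neg B)"
    using decides[of B] modus_ponens[OF to_neg] modus_ponens[OF from_neg] by blast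
  \<comment> \<open>\<open>Neg B\<close> is literally \<open>Imp B Bot\<close>, so detachment
    applies.\<close>
  then have "C Bot"
    using modus_ponens by blast
  with fixpoint decides show ?thesis
    by blast
qed

end
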